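(* Let $\mathcal S$ be a local approximation class in $\mathbb{R}^n$, let $A\subseteq\mathbb{R}^n$ be a nonempty set and let $\varepsilon\geq0$. The following are equivalent: (i) $A$ is locally unilaterally $\varepsilon'$-approximable by $\mathcal S$ for all $\varepsilon'>\varepsilon$; (ii) $\Psi\text{-}\mathrm{Tan}(\overline A,x)\subseteq(\mathcal S;\varepsilon)^\beta_{0,\infty}$ for all $x\in A$; (iii) $\Psi\text{-}\mathrm{Tan}(\overline A,x)\subseteq(\mathcal S;\varepsilon)^\beta_{\mathbb{R}^n,\infty}$ for all $x\in A$.
   Context: $B(x,r)$ denotes the closed ball in $\mathbb{R}^n$ and $\overline A$ the closure of $A$. $\mathfrak C(0)$ is the collection of closed subsets of $\mathbb{R}^n$ containing $0$. For $A,B\subseteq\mathbb{R}^n$ with $B\neq\emptyset$, $\mathrm{ex}(A,B)=\sup_{a\in A}\inf_{b\in B}|a-b|$, with $\mathrm{ex}(\emptyset,B)=0$. Nonempty closed sets $A_i$ converge to a nonempty closed set $A$ (Attouch--Wets topology), $A_i\to A$, if $\mathrm{ex}(A_i\cap B(0,r),A)\to0$ and $\mathrm{ex}(A\cap B(0,r),A_i)\to 0$ for all $r>0$. A local approximation class is a nonempty collection $\mathcal S\subseteq\mathfrak C(0)$ such that $\lambda S\in\mathcal S$ for all $S\in\mathcal S$, $\lambda>0$. Unilateral approximability: $\beta^{\mathcal S}_A(x,r)=\inf_{S\in\mathcal S}\frac1r\,\mathrm{ex}(A\cap B(x,r),x+S)$. $A$ is locally unilaterally $\varepsilon$-approximable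 by $\mathcal S$ if for every compact $K\subseteq A$ there is $r_K>0$ such that $\beta^{\mathcal S}_A(x,r)\leq\varepsilon$ for all $x\in K$ and $0<r\leq r_K$. Enlargements: $(\mathcal S;\varepsilon)^\beta_{0,\infty}=\{D\in\mathfrak C(0):\beta^{\mathcal S}_D(0,r)\leq\varepsilon\text{ for all }r>0\}$ and $(\mathcal S;\varepsilon)^\beta_{\mathbb{R}^n,\infty}=\{D\in\mathfrak C(0):\beta^{\mathcal S}_D(x,r)\leq\varepsilon\text{ for all }x\in D\text{ and all }r>0\}$. For closed $A$ and $x\in A$, $\Psi\text{-}\mathrm{Tan}(A,x)$ is the collection of $T\in\mathfrak C(0)$ for which there exist $x_i\in A$, $r_i>0$ with $x_i\to x$, $r_i\to0$ and $(A-x_i)/r_i\to T$. *)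

theory Defs
  imports "HOL-Analysis.Analysis"
begin

text \<open>Excesses take values in \<^typ>\<open>ennreal\<close>: the supremum may be infinite, and the supremum over
  the empty set is \<open>0\<close>, which gives the convention \<open>ex(\<emptyset>, B) = 0\<close>.
  Only nonempty second arguments are meaningful.\<close>

definition excess :: "'a::metric_space set \<Rightarrow> 'a set \<Rightarrow> ennreal" where
  "excess A B = (SUP a\<in>A. INF b\<in>B. ennreal (dist a b))"

definition closed_sets_through_0 :: "'a::real_normed_vector set set" where
  "closed_sets_through_0 = {S. closed S \<and> 0 \<in> S}"

text \<open>Attouch--Wets convergence; intended for nonempty closed sets.\<close>

definition AW_converges :: "(nat \<Rightarrow> 'a::real_normed_vector set) \<Rightarrow> 'a set \<Rightarrow> bool" where
  "AW_converges F A \<longleftrightarrow>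
     (\<forall>r>0. (\<lambda>i. excess (F i \<inter> cball 0 r) A) \<longlonglongrightarrow> 0 \<and>
            (\<lambda>i. excess (A \<inter> cball 0 r) (F i)) \<longlonglongrightarrow> 0)"

definition local_approximation_class :: "'a::real_normed_vector set set \<Rightarrow> bool" where
  "local_approximation_class \<S> \<longleftrightarrow>
     \<S> \<noteq> {} \<and> \<S> \<subseteq> closed_sets_through_0 \<and>
     (\<forall>S\<in>\<S>. \<forall>c>0. (\<lambda>y. c *\<^sub>R y) ` S \<in> \<S>)"

definition unilateral_approximability ::
    "'a::real_normed_vector set set \<Rightarrow> 'a set \<Rightarrow> 'a \<Rightarrow> real \<Rightarrow> ennreal" where
  "unilateral_approximability \<S> A x r =
     (INF S\<in>\<S>. excess (A \<inter> cball x r) ((\<lambda>y. x + y) ` S) / ennreal r)"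

definition locally_unilaterally_approximable ::
    "'a::real_normed_vector set set \<Rightarrow> real \<Rightarrow> 'a set \<Rightarrow> bool" where
  "locally_unilaterally_approximable \<S> \<epsilon> A \<longleftrightarrow>
     (\<forall>K. compact K \<and> K \<subseteq> A \<longrightarrow>
        (\<exists>r\<^sub>K>0. \<forall>x\<in>K. \<forall>r. 0 < r \<and> r \<le> r\<^sub>K \<longrightarrow>
           unilateral_approximability \<S> A x r \<le> ennreal \<epsilon>))"

definition enlargement_at_0 ::
    "'a::real_normed_vector set set \<Rightarrow> real \<Rightarrow> 'a set set" where
  "enlargement_at_0 \<S> \<epsilon> =
     {D \<in> closed_sets_through_0.
        \<forall>r>0. unilateral_approximability \<S> D 0 r \<le> ennreal \<epsilon>}"

definition enlargement_everywhere ::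
    "'a::real_normed_vector set set \<Rightarrow> real \<Rightarrow> 'a set set" where
  "enlargement_everywhere \<S> \<epsilon> =
     {D \<in> closed_sets_through_0.
        \<forall>x\<in>D. \<forall>r>0. unilateral_approximability \<S> D x r \<le> ennreal \<epsilon>}"

text \<open>The collection \<open>\<Psi>\<close>-\<open>Tan(A, x)\<close>; intended for closed \<open>A\<close> and \<open>x \<in> A\<close>.\<close>

definition pseudotangent_sets ::
    "'a::real_normed_vector set \<Rightarrow> 'a \<Rightarrow> 'a set set" where
  "pseudotangent_sets A x =
     {T \<in> closed_sets_through_0.
        \<exists>(X :: nat \<Rightarrow> 'a) (R :: nat \<Rightarrow> real).
          (\<forall>i. X i \<in> A) \<and> (\<forall>i. R i > 0) \<and> X \<longlonglongrightarrow> x \<and> R \<longlonglongrightarrow> 0 \<and>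
          AW_converges (\<lambda>i. (\<lambda>y. (y - X i) /\<^sub>R R i) ` A) T}"

end

theory Submission
  imports Defs "HOL-Complex_Analysis.Great_Picard"
begin

text \<open>
  Write \<open>\<beta>\<close> for unilateral approximability. Two facts carry the proof. Since \<open>\<S>\<close> is closed under
  dilations, \<open>\<beta>\<close> does not change when the set, the centre and the radius are all transformed by
  \<open>z \<mapsto> (z - x) / r\<close> (\<open>unilateral_approximability_blowup\<close>). Moreover \<open>\<beta>\<close> is stable: if a set \<open>D\<close>
  near a point \<open>t\<close> lies within \<open>\<delta>\<close> of \<open>G\<close>, then \<open>\<beta>\<close> of \<open>D\<close> at \<open>t\<close> exceeds \<open>\<beta>\<close> of \<open>G\<close> at a point
  within \<open>\<delta>\<close> of \<open>t\<close>, and at a slightly larger radius, by an error that tends to \<open>0\<close> with \<open>\<delta>\<close>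
  (\<open>unilateral_approximability_perturb\<close>). So approximability passes between the blow-ups of \<open>A\<close> and
  their Attouch--Wets limits, in either direction.

  From (i) to (iii): let the blow-ups of \<open>closure A\<close> at \<open>X i\<close> and scale \<open>R i\<close> converge to \<open>T\<close>, and let
  \<open>t \<in> T\<close>. Pick \<open>p i\<close> in the corresponding blow-up of \<open>A\<close> itself with \<open>p i \<longlonglongrightarrow> t\<close>. The points
  \<open>a i = X i + R i *\<^sub>R p i\<close> belong to \<open>A\<close> and converge to \<open>x\<close>, so that together with \<open>x\<close> they form a
  compact subset of \<open>A\<close>, on which (i) gives one threshold radius. Rescaled, this
  bounds, for each fixed radius and all large \<open>i\<close>, \<open>\<beta>\<close> of the blow-up at \<open>p i\<close>, and stability carries
  the bound to \<open>T\<close> at \<open>t\<close>.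
  Choosing the centres in \<open>A\<close> deals at once with pseudotangents being taken along \<open>closure A\<close> while (i)
  speaks of \<open>A\<close>, and with centres \<open>t\<close> other than \<open>0\<close>.

  From (iii) to (ii) one specialises to the centre \<open>0\<close>. From (ii) to (i): if (i) fails for some
  \<open>\<epsilon>' > \<epsilon>\<close>, there are points \<open>X i\<close> of a compact \<open>K \<subseteq> A\<close> and radii \<open>R i \<longlonglongrightarrow> 0\<close> at which \<open>\<beta>\<close> of \<open>A\<close>
  exceeds \<open>\<epsilon>'\<close>. By compactness of \<open>K\<close> and of the space of closed sets through \<open>0\<close>
  (\<open>AW_convergent_subsequence\<close>) a subsequence of the blow-ups converges to a pseudotangent \<open>T\<close> at a
  point of \<open>K\<close>. Then \<open>\<beta>\<close> of \<open>T\<close> at \<open>0\<close> is at most \<open>\<epsilon>\<close> at all radii, and stability gives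
  \<open>\<beta> \<le> \<epsilon>'\<close> for some blow-up at radius \<open>1\<close>, which contradicts the choice of \<open>X\<close> and \<open>R\<close>.
\<close>

section \<open>Excess and distance to a set\<close>

lemma infdist_less_obtain:
  assumes "infdist x A < d" "A \<noteq> {}"
  obtains a where "a \<in> A" "dist x a < d"
  using assms by (auto simp: infdist_notempty cINF_less_iff)

lemma infdist_greatest:
  assumes "A \<noteq> {}" "\<And>a. a \<in> A \<Longrightarrow> d \<le> dist x a"
  shows "d \<le> infdist x A"
  using assms by (auto simp: infdist_notempty intro!: cINF_greatest)

lemma INF_ennreal_dist_eq_infdist:
  assumes "B \<noteq> {}"
  shows "(INF b\<in>B. ennreal (dist a b)) = ennreal (infdist a B)"
proof (rule antisym)
  show "(INF b\<in>B. ennreal (dist a b)) \<le> ennreal (infdist a B)"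
    unfolding INF_le_iff
  proof (intro allI impI)
    fix y assume y: "ennreal (infdist a B) < y"
    show "\<exists>i\<in>B. ennreal (dist a i) < y"
    proof (cases y)
      case (real d)
      then have "infdist a B < d"
        using y by (simp add: ennreal_less_iff infdist_nonneg)
      then obtain b where "b \<in> B" "dist a b < d"
        using assms infdist_less_obtain by blast
      then show ?thesis using real by (auto simp: ennreal_less_iff)
    next
      case top
      then show ?thesis using assms by auto
    qed
  qed
  show "ennreal (infdist a B) \<le> (INF b\<in>B. ennreal (dist a b))"
    by (intro INF_greatest ennreal_leI infdist_le)
qed

text \<open>Bounds on excesses, which are extended reals, become pointwise bounds on the real function
  \<open>infdist\<close>, whose Lipschitz property replaces all computations with the supremum and infimum.\<close>

lemma excess_le_iff:
  assumes "B \<noteq> {}" "e \<ge> 0"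
  shows "excess A B \<le> ennreal e \<longleftrightarrow> (\<forall>a\<in>A. infdist a B \<le> e)"
  using assms by (simp add: excess_def INF_ennreal_dist_eq_infdist SUP_le_iff ennreal_le_iff)

lemma infdist_affine_image:
  fixes x y :: "'a::real_normed_vector"
  assumes "c > 0"
  shows "infdist (x + c *\<^sub>R y) ((\<lambda>s. x + c *\<^sub>R s) ` S) = c * infdist y S"
proof (cases "S = {}")
  case True
  then show ?thesis by (simp add: infdist_def)
next
  case False
  have d: "dist (x + c *\<^sub>R y) (x + c *\<^sub>R s) = c * dist y s" for s
    using assms by (simp add: dist_norm flip: scaleR_diff_right)
  show ?thesis
  proof (rule antisym)
    have "infdist (x + c *\<^sub>R y) ((\<lambda>s. x + c *\<^sub>R s) ` S) / c \<le> infdist y S"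
    proof (rule infdist_greatest[OF False])
      fix s assume "s \<in> S"
      then have "infdist (x + c *\<^sub>R y) ((\<lambda>s. x + c *\<^sub>R s) ` S) \<le> c * dist y s"
        by (metis d imageI infdist_le)
      then show "infdist (x + c *\<^sub>R y) ((\<lambda>s. x + c *\<^sub>R s) ` S) / c \<le> dist y s"
        using assms by (simp add: field_simps)
    qed
    then show "infdist (x + c *\<^sub>R y) ((\<lambda>s. x + c *\<^sub>R s) ` S) \<le> c * infdist y S"
      using assms by (simp add: field_simps)
    show "c * infdist y S \<le> infdist (x + c *\<^sub>R y) ((\<lambda>s. x + c *\<^sub>R s) ` S)"
      using False assms d by (intro infdist_greatest) (auto intro!: infdist_le)
  qed
qed

lemma infdist_translation:
  fixes x a :: "'a::real_normed_vector"
  shows "infdist a ((\<lambda>s. x + s) ` S) = infdist (a - x) S"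
  using infdist_affine_image[of 1 x "a - x" S] by simp

lemma infdist_scaleR_image:
  fixes y :: "'a::real_normed_vector"
  assumes "c > 0"
  shows "infdist (c *\<^sub>R y) ((\<lambda>s. c *\<^sub>R s) ` S) = c * infdist y S"
  using infdist_affine_image[OF assms, of 0 y S] by simp

lemma infdist_blowup:
  fixes x y :: "'a::real_normed_vector"
  assumes "r > 0"
  shows "infdist y ((\<lambda>z. (z - x) /\<^sub>R r) ` A) = infdist (x + r *\<^sub>R y) A / r"
proof -
  have "infdist (x + r *\<^sub>R y) ((\<lambda>s. x + r *\<^sub>R s) ` (\<lambda>z. (z - x) /\<^sub>R r) ` A)
      = r * infdist y ((\<lambda>z. (z - x) /\<^sub>R r) ` A)"
    by (rule infdist_affine_image[OF assms])
  moreover have "(\<lambda>s. x + r *\<^sub>R s) ` (\<lambda>z. (z - x) /\<^sub>R r) ` A = A"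
    using assms by (simp add: image_image)
  ultimately show ?thesis using assms by simp
qed

text \<open>Hence pseudotangents of \<open>closure A\<close> can be studied through blow-ups of \<open>A\<close> itself.\<close>

lemma infdist_blowup_closure:
  fixes x y :: "'a::real_normed_vector"
  assumes "r > 0"
  shows "infdist y ((\<lambda>z. (z - x) /\<^sub>R r) ` closure A) = infdist y ((\<lambda>z. (z - x) /\<^sub>R r) ` A)"
  unfolding infdist_blowup[OF assms] by (simp add: infdist_eq_setdist)

section \<open>Attouch--Wets convergence\<close>

lemma ennreal_tendsto_0_iff_eventually_le:
  fixes f :: "nat \<Rightarrow> ennreal"
  shows "f \<longlonglongrightarrow> 0 \<longleftrightarrow> (\<forall>\<delta>>0. \<forall>\<^sub>F i in sequentially. f i \<le> ennreal \<delta>)"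
proof (intro iffI allI impI)
  fix \<delta> :: real assume "f \<longlonglongrightarrow> 0" "\<delta> > 0"
  then have "\<forall>\<^sub>F i in sequentially. f i < ennreal \<delta>"
    by (intro order_tendstoD) auto
  then show "\<forall>\<^sub>F i in sequentially. f i \<le> ennreal \<delta>"
    by eventually_elim simp
next
  assume *: "\<forall>\<delta>>0. \<forall>\<^sub>F i in sequentially. f i \<le> ennreal \<delta>"
  show "f \<longlonglongrightarrow> 0"
  proof (rule order_tendstoI)
    fix y :: ennreal assume "0 < y"
    then obtain z where z: "0 < z" "z < y" using dense by blast
    then obtain \<delta> where \<delta>: "z = ennreal \<delta>" "\<delta> > 0"
      by (cases z) auto
    have "\<forall>\<^sub>F i in sequentially. f i \<le> ennreal \<delta>"
      using * \<delta> by blast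
    then show "\<forall>\<^sub>F i in sequentially. f i < y"
      by eventually_elim (use z \<delta> in auto)
  qed auto
qed

lemma AW_converges_iff:
  fixes F :: "nat \<Rightarrow> 'a::real_normed_vector set"
  assumes "\<And>i. F i \<noteq> {}" "A \<noteq> {}"
  shows "AW_converges F A \<longleftrightarrow>
    (\<forall>r>0. \<forall>\<delta>>0. \<forall>\<^sub>F i in sequentially.
      (\<forall>y\<in>F i \<inter> cball 0 r. infdist y A \<le> \<delta>) \<and> (\<forall>y\<in>A \<inter> cball 0 r. infdist y (F i) \<le> \<delta>))"
  using assms
  by (simp add: AW_converges_def ennreal_tendsto_0_iff_eventually_le excess_le_iff
      eventually_conj_iff all_conj_distrib imp_conjR cong: imp_cong)

lemma AW_convergesD:
  fixes F :: "nat \<Rightarrow> 'a::real_normed_vector set"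
  assumes AW: "AW_converges F A" and "\<And>i. F i \<noteq> {}" "A \<noteq> {}" "r > 0" "\<delta> > 0"
  shows "\<forall>\<^sub>F i in sequentially. \<forall>y\<in>F i \<inter> cball 0 r. infdist y A \<le> \<delta>"
    and "\<forall>\<^sub>F i in sequentially. \<forall>y\<in>A \<inter> cball 0 r. infdist y (F i) \<le> \<delta>"
  using AW assms(4,5) unfolding AW_converges_iff[OF assms(2,3)] eventually_conj_iff by blast+

text \<open>A diagonal argument gives a subsequence converging on a countable dense set; the common
  Lipschitz constant extends convergence to every point.\<close>

lemma equi_Lipschitz_pointwise_convergent_subsequence:
  fixes f :: "nat \<Rightarrow> 'a::euclidean_space \<Rightarrow> real"
  assumes lip: "\<And>n x y. \<bar>f n x - f n y\<bar> \<le> dist x y"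
    and zero: "\<And>n. f n 0 = 0"
  obtains k :: "nat \<Rightarrow> nat" where "strict_mono k" "\<And>x. convergent (\<lambda>n. f (k n) x)"
proof -
  obtain D :: "'a set" where D: "countable D" "\<And>X. open X \<Longrightarrow> X \<noteq> {} \<Longrightarrow> \<exists>d\<in>D. d \<in> X"
    using countable_dense_exists by blast
  \<comment> \<open>The weight \<open>1 + norm x\<close> makes the functions uniformly bounded, as the diagonal argument
    requires.\<close>
  have bound: "norm (f n x / (1 + norm x)) \<le> 1" for n x
    using lip[of n x 0] zero[of n] by (simp add: divide_le_eq)
  obtain k where k: "strict_mono (k::nat\<Rightarrow>nat)"
    and lim: "\<And>x. x \<in> D \<Longrightarrow> \<exists>l. (\<lambda>n. f (k n) x / (1 + norm x)) \<longlonglongrightarrow> l"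
    using function_convergent_subsequence[OF D(1), of "\<lambda>n x. f n x / (1 + norm x)" 1] bound
    by blast
  have convD: "Cauchy (\<lambda>n. f (k n) x)" if x: "x \<in> D" for x
  proof -
    obtain l where "(\<lambda>n. f (k n) x / (1 + norm x)) \<longlonglongrightarrow> l"
      using lim[OF x] by blast
    then have "(\<lambda>n. f (k n) x / (1 + norm x) * (1 + norm x)) \<longlonglongrightarrow> l * (1 + norm x)"
      by (intro tendsto_intros)
    moreover have "1 + norm x \<noteq> 0"
      using norm_ge_zero[of x] by linarith
    ultimately have "(\<lambda>n. f (k n) x) \<longlonglongrightarrow> l * (1 + norm x)"
      by simp
    then show ?thesis by (rule LIMSEQ_imp_Cauchy)
  qed
  have "Cauchy (\<lambda>n. f (k n) x)" for x
  proof (rule metric_CauchyI)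
    fix e :: real assume "e > 0"
    then obtain q where q: "q \<in> D" "dist x q < e / 3"
      using D(2)[of "ball x (e/3)"] by auto
    obtain N where N: "\<And>m n. m \<ge> N \<Longrightarrow> n \<ge> N \<Longrightarrow> dist (f (k m) q) (f (k n) q) < e / 3"
      using metric_CauchyD[OF convD[OF q(1)], of "e/3"] \<open>e > 0\<close> by auto
    have "dist (f (k m) x) (f (k n) x) < e" if "m \<ge> N" "n \<ge> N" for m n
      using N[OF that] lip[of "k m" x q] lip[of "k n" x q] q(2)
      unfolding dist_real_def by linarith
    then show "\<exists>N. \<forall>m\<ge>N. \<forall>n\<ge>N. dist (f (k m) x) (f (k n) x) < e" by blast
  qed
  then show thesis
    using that k by (simp add: Cauchy_convergent)
qed

text \<open>Sequential compactness of the closed sets through \<open>0\<close>. The distance functions of the \<open>F n\<close> are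
  1-Lipschitz and vanish at \<open>0\<close>, so a subsequence of them converges pointwise to some \<open>l\<close>; the limit
  set is the zero set of \<open>l\<close>. If either excess stayed away from \<open>0\<close> on some ball, the offending
  points would accumulate at some \<open>b\<close>, and comparing the distance functions along these points with
  \<open>l b\<close> gives a contradiction.\<close>

lemma AW_convergent_subsequence:
  fixes F :: "nat \<Rightarrow> 'a::euclidean_space set"
  assumes F0: "\<And>n. 0 \<in> F n"
  obtains k :: "nat \<Rightarrow> nat" and T where "strict_mono k" "T \<in> closed_sets_through_0"
    "AW_converges (F \<circ> k) T"
proof -
  obtain k where k: "strict_mono k" and conv: "\<And>x. convergent (\<lambda>n. infdist x (F (k n)))"
    using equi_Lipschitz_pointwise_convergent_subsequence[of "\<lambda>n x. infdist x (F n)"]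
      infdist_triangle_abs F0 by (metis infdist_zero)
  define d where "d n x = infdist x (F (k n))" for n x
  define l where "l x = lim (\<lambda>n. d n x)" for x
  have dl: "(\<lambda>n. d n x) \<longlonglongrightarrow> l x" for x
    using conv unfolding d_def l_def by (simp add: convergent_LIMSEQ_iff)
  have moving: "(\<lambda>n. d (s n) (a n)) \<longlonglongrightarrow> l b" if "strict_mono s" "a \<longlonglongrightarrow> b" for s a b
  proof -
    have "(\<lambda>n. dist (a n) b) \<longlonglongrightarrow> 0"
      using that(2) tendsto_dist_iff by blast
    then have "(\<lambda>n. d (s n) (a n) - d (s n) b) \<longlonglongrightarrow> 0"
      by (rule Lim_null_comparison[rotated])
        (auto simp: d_def infdist_triangle_abs)
    moreover have "(\<lambda>n. d (s n) b) \<longlonglongrightarrow> l b"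
      using LIMSEQ_subseq_LIMSEQ[OF dl that(1)] by (simp add: o_def)
    ultimately show ?thesis
      using tendsto_add by fastforce
  qed
  define T where "T = {x. l x = 0}"
  have T0: "0 \<in> T"
    using dl[of 0] F0 by (simp add: T_def d_def LIMSEQ_const_iff)
  have l_lip: "\<bar>l x - l y\<bar> \<le> dist x y" for x y
    by (rule LIMSEQ_le_const2[OF tendsto_rabs[OF tendsto_diff[OF dl dl]]])
      (auto simp: d_def infdist_triangle_abs)
  have "continuous_on UNIV l"
    unfolding continuous_on_iff dist_real_def
    by (metis l_lip dist_commute le_less_trans)
  then have "closed (l -` {0})"
    by (intro closed_vimage) auto
  then have closedT: "closed T"
    by (simp add: T_def vimage_def)
  have "AW_converges (F \<circ> k) T"
  proof (subst AW_converges_iff)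
    show "(F \<circ> k) i \<noteq> {}" for i
      using F0[of "k i"] by auto
    show "T \<noteq> {}" using T0 by auto
    show "\<forall>r>0. \<forall>\<delta>>0. \<forall>\<^sub>F i in sequentially.
      (\<forall>y\<in>(F \<circ> k) i \<inter> cball 0 r. infdist y T \<le> \<delta>) \<and> (\<forall>y\<in>T \<inter> cball 0 r. infdist y ((F \<circ> k) i) \<le> \<delta>)"
    proof (intro allI impI eventually_conj)
      fix r \<delta> :: real assume "r > 0" "\<delta> > 0"
      show "\<forall>\<^sub>F i in sequentially. \<forall>y\<in>(F \<circ> k) i \<inter> cball 0 r. infdist y T \<le> \<delta>"
      proof (rule ccontr)
        assume "\<not> ?thesis"
        from not_eventually_sequentiallyD[OF this]
        obtain s a where s: "strict_mono (s::nat\<Rightarrow>nat)"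
          and a: "\<And>n. a n \<in> F (k (s n))" "\<And>n. a n \<in> cball 0 r" "\<And>n. \<not> infdist (a n) T \<le> \<delta>"
          unfolding o_def Ball_def not_all not_imp Int_iff choice_iff by blast
        obtain b u where u: "strict_mono (u::nat\<Rightarrow>nat)" and lim: "(a \<circ> u) \<longlonglongrightarrow> b"
          using compact_cball[of 0 r] a(2) unfolding compact_def by blast
        have "(\<lambda>n. d ((s \<circ> u) n) ((a \<circ> u) n)) \<longlonglongrightarrow> l b"
          by (intro moving strict_mono_o s u lim)
        moreover have "d ((s \<circ> u) n) ((a \<circ> u) n) = 0" for n
          using a(1) by (simp add: d_def)
        ultimately have "b \<in> T"
          by (simp add: T_def LIMSEQ_const_iff)
        have "\<forall>\<^sub>F n in sequentially. dist ((a \<circ> u) n) b < \<delta>"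
          using lim \<open>\<delta> > 0\<close> by (rule tendstoD)
        then obtain n where "dist (a (u n)) b < \<delta>"
          by (auto simp: eventually_sequentially)
        then show False
          using infdist_le[OF \<open>b \<in> T\<close>, of "a (u n)"] a(3)[of "u n"] by linarith
      qed
      show "\<forall>\<^sub>F i in sequentially. \<forall>y\<in>T \<inter> cball 0 r. infdist y ((F \<circ> k) i) \<le> \<delta>"
      proof (rule ccontr)
        assume "\<not> ?thesis"
        from not_eventually_sequentiallyD[OF this]
        obtain s a where s: "strict_mono (s::nat\<Rightarrow>nat)"
          and a: "\<And>n. a n \<in> T" "\<And>n. a n \<in> cball 0 r" "\<And>n. \<not> d (s n) (a n) \<le> \<delta>"
          unfolding d_def o_def Ball_def not_all not_imp Int_iff choice_iff by blast
        obtain b u where u: "strict_mono (u::nat\<Rightarrow>nat)" and lim: "(a \<circ> u) \<longlonglongrightarrow> b"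
          using compact_cball[of 0 r] a(2) unfolding compact_def by blast
        have "b \<in> T"
          using closed_sequentially[OF closedT _ lim] a(1) by simp
        moreover have "(\<lambda>n. d ((s \<circ> u) n) ((a \<circ> u) n)) \<longlonglongrightarrow> l b"
          by (intro moving strict_mono_o s u lim)
        ultimately have "\<forall>\<^sub>F n in sequentially. d ((s \<circ> u) n) ((a \<circ> u) n) < \<delta>"
          using \<open>\<delta> > 0\<close> by (auto simp: T_def intro: order_tendstoD)
        then obtain n where "d (s (u n)) (a (u n)) < \<delta>"
          by (auto simp: eventually_sequentially)
        then show False
          using a(3)[of "u n"] by linarith
      qed
    qed
  qed
  then show thesis
    using that k closedT T0 by (auto simp: closed_sets_through_0_def)
qed

section \<open>Unilateral approximability\<close>

lemma local_approximation_class_no_empty_set: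
  assumes "local_approximation_class \<S>"
  shows "{} \<notin> \<S>"
  using assms by (auto simp: local_approximation_class_def closed_sets_through_0_def)

text \<open>The infimum over \<open>\<S>\<close> need not be attained, hence the quantification over all \<open>e' > e\<close>.\<close>

lemma unilateral_approximability_le_iff:
  fixes \<S> :: "'a::real_normed_vector set set"
  assumes \<S>: "{} \<notin> \<S>" and "r > 0" "e \<ge> 0"
  shows "unilateral_approximability \<S> A x r \<le> ennreal e \<longleftrightarrow>
    (\<forall>e'>e. \<exists>S\<in>\<S>. \<forall>a\<in>A \<inter> cball x r. infdist (a - x) S \<le> e' * r)"
proof -
  have bound: "excess (A \<inter> cball x r) ((\<lambda>y. x + y) ` S) \<le> ennreal (e' * r) \<longleftrightarrow>
      (\<forall>a\<in>A \<inter> cball x r. infdist (a - x) S \<le> e' * r)" if "S \<in> \<S>" "e' > e" for S e'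
  proof -
    have "S \<noteq> {}"
      using \<S> that(1) by auto
    then show ?thesis
      using assms that(2) by (subst excess_le_iff) (auto simp: infdist_translation)
  qed
  have div: "X / ennreal r \<le> ennreal e' \<longleftrightarrow> X \<le> ennreal (e' * r)" if "e' > e" for X e'
    using assms that by (cases X)
      (auto simp: divide_ennreal ennreal_le_iff divide_le_eq ennreal_top_divide top_unique)
  show ?thesis
  proof (intro iffI allI impI)
    fix e' assume le: "unilateral_approximability \<S> A x r \<le> ennreal e" and "e' > e"
    then have "ennreal e < ennreal e'"
      using assms by (simp add: ennreal_less_iff)
    then obtain S where "S \<in> \<S>"
      "excess (A \<inter> cball x r) ((\<lambda>y. x + y) ` S) / ennreal r < ennreal e'"
      using le unfolding unilateral_approximability_def INF_le_iff by blast
    then show "\<exists>S\<in>\<S>. \<forall>a\<in>A \<inter> cball x r. infdist (a - x) S \<le> e' * r"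
      using bound div \<open>e' > e\<close> less_imp_le by blast
  next
    assume *: "\<forall>e'>e. \<exists>S\<in>\<S>. \<forall>a\<in>A \<inter> cball x r. infdist (a - x) S \<le> e' * r"
    show "unilateral_approximability \<S> A x r \<le> ennreal e"
    proof (rule ennreal_le_epsilon)
      fix \<eta> :: real assume "\<eta> > 0"
      then obtain S where "S \<in> \<S>" "\<forall>a\<in>A \<inter> cball x r. infdist (a - x) S \<le> (e + \<eta>) * r"
        using * by (metis less_add_same_cancel1)
      then have "unilateral_approximability \<S> A x r \<le> ennreal (e + \<eta>)"
        unfolding unilateral_approximability_def using bound div \<open>\<eta> > 0\<close>
        by (intro INF_lower2[of S]) auto
      then show "unilateral_approximability \<S> A x r \<le> ennreal e + ennreal \<eta>"
        using assms \<open>\<eta> > 0\<close> by simp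
    qed
  qed
qed

text \<open>If \<open>S \<in> \<S>\<close> approximates \<open>A\<close> near \<open>x + r *\<^sub>R p\<close> at radius \<open>r * s\<close>, then the dilate of \<open>S\<close> by
  \<open>1 / r\<close>, again a member of \<open>\<S>\<close>, approximates the blow-up near \<open>p\<close> at radius \<open>s\<close>.\<close>

lemma unilateral_approximability_blowup:
  fixes \<S> :: "'a::real_normed_vector set set"
  assumes \<S>: "local_approximation_class \<S>" and "r > 0" "s > 0" "e \<ge> 0"
    and le: "unilateral_approximability \<S> A (x + r *\<^sub>R p) (r * s) \<le> ennreal e"
  shows "unilateral_approximability \<S> ((\<lambda>z. (z - x) /\<^sub>R r) ` A) p s \<le> ennreal e"
  unfolding unilateral_approximability_le_iff[OF local_approximation_class_no_empty_set[OF \<S>]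
      \<open>s > 0\<close> \<open>e \<ge> 0\<close>]
proof (intro allI impI)
  fix e' assume "e' > e"
  have "r * s > 0" using assms by simp
  from le[unfolded unilateral_approximability_le_iff[OF local_approximation_class_no_empty_set[OF \<S>]
        this \<open>e \<ge> 0\<close>]]
    \<open>e' > e\<close>
  obtain S where S: "S \<in> \<S>"
    "\<And>a. a \<in> A \<Longrightarrow> dist (x + r *\<^sub>R p) a \<le> r * s \<Longrightarrow> infdist (a - (x + r *\<^sub>R p)) S \<le> e' * (r * s)"
    by (auto simp: mem_cball)
  let ?S = "(\<lambda>y. inverse r *\<^sub>R y) ` S"
  have "?S \<in> \<S>"
    using \<S> S(1) \<open>r > 0\<close> by (simp add: local_approximation_class_def)
  moreover have "infdist ((a - x) /\<^sub>R r - p) ?S \<le> e' * s"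
    if "a \<in> A" "dist p ((a - x) /\<^sub>R r) \<le> s" for a
  proof -
    have eq: "(a - x) /\<^sub>R r - p = inverse r *\<^sub>R (a - (x + r *\<^sub>R p))"
      using \<open>r > 0\<close> by (simp add: algebra_simps)
    have "norm (inverse r *\<^sub>R (a - (x + r *\<^sub>R p))) \<le> s"
      using that(2) unfolding eq[symmetric] by (simp add: dist_norm norm_minus_commute)
    then have "norm (a - (x + r *\<^sub>R p)) / r \<le> s"
      using \<open>r > 0\<close> by (simp add: divide_inverse_commute)
    then have "dist (x + r *\<^sub>R p) a \<le> r * s"
      using \<open>r > 0\<close> by (simp add: dist_norm norm_minus_commute field_simps)
    then have "infdist (a - (x + r *\<^sub>R p)) S \<le> e' * (r * s)"
      using S(2) that(1) by blast
    then show ?thesis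
      unfolding eq using \<open>r > 0\<close> by (subst infdist_scaleR_image) (auto simp: field_simps)
  qed
  ultimately show "\<exists>S\<in>\<S>. \<forall>a\<in>(\<lambda>z. (z - x) /\<^sub>R r) ` A \<inter> cball p s. infdist (a - p) S \<le> e' * s"
    by (intro bexI[of _ ?S]) auto
qed

text \<open>Undoing a blow-up is again a blow-up, at \<open>- x /\<^sub>R r\<close> and scale \<open>1 / r\<close>.\<close>

lemma unilateral_approximability_blowupD:
  fixes \<S> :: "'a::real_normed_vector set set"
  assumes \<S>: "local_approximation_class \<S>" and "r > 0" "e \<ge> 0"
    and le: "unilateral_approximability \<S> ((\<lambda>z. (z - x) /\<^sub>R r) ` A) 0 1 \<le> ennreal e"
  shows "unilateral_approximability \<S> A x r \<le> ennreal e"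
proof -
  let ?B = "(\<lambda>z. (z - x) /\<^sub>R r) ` A"
  have "unilateral_approximability \<S> ((\<lambda>z. (z - (- x /\<^sub>R r)) /\<^sub>R inverse r) ` ?B) x r \<le> ennreal e"
  proof (rule unilateral_approximability_blowup[OF \<S> _ \<open>r > 0\<close> \<open>e \<ge> 0\<close>])
    have "- x /\<^sub>R r + inverse r *\<^sub>R x = 0" "inverse r * r = 1"
      using \<open>r > 0\<close> by auto
    then show "unilateral_approximability \<S> ?B (- x /\<^sub>R r + inverse r *\<^sub>R x) (inverse r * r) \<le> ennreal e"
      using le by simp
  qed (use \<open>r > 0\<close> in simp)
  also have "(\<lambda>z. (z - (- x /\<^sub>R r)) /\<^sub>R inverse r) ` ?B = A"
    using \<open>r > 0\<close> by (simp add: image_image scaleR_add_right)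
  finally show ?thesis .
qed

text \<open>A point \<open>u\<close> of \<open>D\<close> within \<open>r\<close> of \<open>t\<close> has some \<open>v \<in> G\<close> closer than \<open>\<delta>\<close>, and \<open>v\<close> is within
  \<open>r + 2 * \<delta>\<close> of \<open>p\<close>. A set \<open>S\<close> that is good for \<open>G\<close> at \<open>p\<close> is therefore good for \<open>D\<close> at \<open>t\<close>: the
  difference of \<open>u - t\<close> and \<open>v - p\<close> adds another \<open>2 * \<delta>\<close>, so the error at radius \<open>r\<close> is at most
  \<open>e * (r + 2 * \<delta>) + 2 * \<delta>\<close>, up to the slack of the infimum.\<close>

lemma unilateral_approximability_perturb:
  fixes \<S> :: "'a::real_normed_vector set set"
  assumes \<S>: "{} \<notin> \<S>" and "r > 0" "e \<ge> 0" "\<delta> > 0" "G \<noteq> {}"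
    and near: "\<And>u. u \<in> D \<Longrightarrow> dist t u \<le> r \<Longrightarrow> infdist u G < \<delta>"
    and "dist t p \<le> \<delta>"
    and le: "unilateral_approximability \<S> G p (r + 2 * \<delta>) \<le> ennreal e"
  shows "unilateral_approximability \<S> D t r \<le> ennreal (e + 2 * \<delta> * (1 + e) / r)"
proof -
  have "r + 2 * \<delta> > 0" using assms by simp
  note le' = le[unfolded unilateral_approximability_le_iff[OF \<S> this \<open>e \<ge> 0\<close>]]
  have "e + 2 * \<delta> * (1 + e) / r \<ge> 0" using assms by simp
  show ?thesis
    unfolding unilateral_approximability_le_iff[OF \<S> \<open>r > 0\<close> \<open>e + 2 * \<delta> * (1 + e) / r \<ge> 0\<close>]
  proof (intro allI impI)
    fix e' assume e': "e' > e + 2 * \<delta> * (1 + e) / r"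
    \<comment> \<open>Chosen so that the error \<open>e'' * (r + 2 * \<delta>) + 2 * \<delta>\<close> is exactly \<open>e' * r\<close>.\<close>
    define e'' where "e'' = (e' * r - 2 * \<delta>) / (r + 2 * \<delta>)"
    have e''eq: "e'' * (r + 2 * \<delta>) = e' * r - 2 * \<delta>"
      using \<open>r + 2 * \<delta> > 0\<close> by (simp add: e''_def)
    have "e'' > e"
      using e' assms \<open>r + 2 * \<delta> > 0\<close> by (simp add: e''_def field_simps)
    then obtain S where S: "S \<in> \<S>"
      "\<And>v. v \<in> G \<Longrightarrow> dist p v \<le> r + 2 * \<delta> \<Longrightarrow> infdist (v - p) S \<le> e'' * (r + 2 * \<delta>)"
      using le' by (auto simp: mem_cball)
    have "infdist (u - t) S \<le> e' * r" if u: "u \<in> D" "dist t u \<le> r" for u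
    proof -
      obtain v where v: "v \<in> G" "dist u v < \<delta>"
        using infdist_less_obtain[OF near[OF u] \<open>G \<noteq> {}\<close>] by blast
      have "dist p v \<le> r + 2 * \<delta>"
        using v(2) u(2) \<open>dist t p \<le> \<delta>\<close> dist_triangle[of p v t] dist_triangle[of t v u]
        by (simp add: dist_commute)
      then have "infdist (v - p) S \<le> e' * r - 2 * \<delta>"
        using S(2)[OF v(1)] e''eq by simp
      moreover have "infdist (u - t) S \<le> infdist (v - p) S + dist (u - t) (v - p)"
        by (rule infdist_triangle)
      moreover have "dist (u - t) (v - p) \<le> dist u v + dist t p"
        using norm_triangle_ineq4[of "u - v" "t - p"] by (simp add: dist_norm algebra_simps)
      ultimately show ?thesis
        using v(2) \<open>dist t p \<le> \<delta>\<close> by linarith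
    qed
    then show "\<exists>S\<in>\<S>. \<forall>a\<in>D \<inter> cball t r. infdist (a - t) S \<le> e' * r"
      using S(1) by (intro bexI[of _ S]) auto
  qed
qed

section \<open>Approximability and pseudotangents\<close>

text \<open>The hypothesis gives uniform bounds only at the points of compact subsets of \<open>A\<close>. The centres of the blow-ups are
  therefore moved from points of \<open>closure A\<close> to points of \<open>A\<close>, which together with their limit \<open>x\<close>
  form such a compact set.\<close>

lemma pseudotangent_sets_subset_enlargement_everywhere:
  fixes \<S> :: "'a::euclidean_space set set"
  assumes \<S>: "local_approximation_class \<S>" and "\<epsilon> \<ge> 0" "x \<in> A"
    and approx: "\<And>\<epsilon>'. \<epsilon>' > \<epsilon> \<Longrightarrow> locally_unilaterally_approximable \<S> \<epsilon>' A"
  shows "pseudotangent_sets (closure A) x \<subseteq> enlargement_everywhere \<S> \<epsilon>"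
proof
  fix T assume "T \<in> pseudotangent_sets (closure A) x"
  then obtain X R where T: "T \<in> closed_sets_through_0"
    and R: "\<And>i. R i > 0" "R \<longlonglongrightarrow> 0" and X: "X \<longlonglongrightarrow> x"
    and AW: "AW_converges (\<lambda>i. (\<lambda>y. (y - X i) /\<^sub>R R i) ` closure A) T"
    by (auto simp: pseudotangent_sets_def)
  define G where "G i = (\<lambda>y. (y - X i) /\<^sub>R R i) ` A" for i
  have "A \<noteq> {}" "closure A \<noteq> {}" using \<open>x \<in> A\<close> closure_subset by auto
  have G: "G i \<noteq> {}" for i using \<open>A \<noteq> {}\<close> by (simp add: G_def)
  have near: "\<forall>\<^sub>F i in sequentially. \<forall>u\<in>T \<inter> cball 0 r. infdist u (G i) < \<delta>"
    if "r > 0" "\<delta> > 0" for r \<delta>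
  proof -
    have "\<forall>\<^sub>F i in sequentially. \<forall>u\<in>T \<inter> cball 0 r. infdist u (G i) \<le> \<delta> / 2"
      using AW_convergesD(2)[OF AW, of r "\<delta> / 2"] T \<open>closure A \<noteq> {}\<close> that
      by (auto simp: closed_sets_through_0_def infdist_blowup_closure[OF R(1)] G_def)
    then show ?thesis
      by eventually_elim (use that in force)
  qed
  have "unilateral_approximability \<S> T t r \<le> ennreal \<epsilon>" if "t \<in> T" "r > 0" for t r
  proof -
    have "\<exists>p\<in>G i. dist t p < infdist t (G i) + inverse (real (Suc i))" for i
      using infdist_less_obtain[of t "G i"] G
      by (metis less_add_same_cancel1 inverse_positive_iff_positive of_nat_0_less_iff zero_less_Suc)
    then obtain p where p: "\<And>i. p i \<in> G i"
      "\<And>i. dist t (p i) < infdist t (G i) + inverse (real (Suc i))"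
      by metis
    have "(\<lambda>i. infdist t (G i)) \<longlonglongrightarrow> 0"
    proof (rule order_tendstoI)
      fix \<delta> :: real assume "0 < \<delta>"
      then have "\<forall>\<^sub>F i in sequentially. \<forall>u\<in>T \<inter> cball 0 (norm t + 1). infdist u (G i) < \<delta>"
        by (intro near) (auto intro: add_nonneg_pos)
      then show "\<forall>\<^sub>F i in sequentially. infdist t (G i) < \<delta>"
        by eventually_elim (use that in auto)
    qed (auto intro: always_eventually less_le_trans[OF _ infdist_nonneg])
    then have "(\<lambda>i. infdist t (G i) + inverse (real (Suc i))) \<longlonglongrightarrow> 0"
      using LIMSEQ_inverse_real_of_nat tendsto_add_zero by blast
    then have dist_p: "(\<lambda>i. dist t (p i)) \<longlonglongrightarrow> 0"
      by (rule Lim_null_comparison[rotated])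
        (use less_imp_le[OF p(2)] in \<open>simp add: always_eventually\<close>)
    then have "p \<longlonglongrightarrow> t"
      by (subst tendsto_dist_iff) (simp add: dist_commute)
    define a where "a i = X i + R i *\<^sub>R p i" for i
    have aA: "a i \<in> A" for i
      using p(1)[of i] R(1)[of i] by (auto simp: a_def G_def)
    have "a \<longlonglongrightarrow> x + 0 *\<^sub>R t"
      unfolding a_def by (intro tendsto_intros X R \<open>p \<longlonglongrightarrow> t\<close>)
    then have "a \<longlonglongrightarrow> x" by simp
    then have K: "compact (insert x (range a))"
      by (rule compact_sequence_with_limit)
    have step: "unilateral_approximability \<S> T t r \<le> ennreal (\<epsilon>' + 2 * \<delta> * (1 + \<epsilon>') / r)"
      if "\<epsilon>' > \<epsilon>" "\<delta> > 0" for \<epsilon>' \<delta>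
    proof -
      have "insert x (range a) \<subseteq> A"
        using aA \<open>x \<in> A\<close> by blast
      then have "\<exists>rK>0. \<forall>y\<in>insert x (range a). \<forall>\<rho>. 0 < \<rho> \<and> \<rho> \<le> rK \<longrightarrow>
          unilateral_approximability \<S> A y \<rho> \<le> ennreal \<epsilon>'"
        by (intro approx[OF \<open>\<epsilon>' > \<epsilon>\<close>, unfolded locally_unilaterally_approximable_def, rule_format]
            conjI K)
      then obtain rK where rK: "rK > 0" "\<And>i \<rho>. 0 < \<rho> \<Longrightarrow> \<rho> \<le> rK \<Longrightarrow>
          unilateral_approximability \<S> A (a i) \<rho> \<le> ennreal \<epsilon>'"
        by blast
      have "(\<lambda>i. R i * (r + 2 * \<delta>)) \<longlonglongrightarrow> 0"
        using R(2) by (rule tendsto_mult_left_zero)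
      then have "\<forall>\<^sub>F i in sequentially. R i * (r + 2 * \<delta>) < rK"
        using rK(1) by (rule order_tendstoD)
      moreover have "\<forall>\<^sub>F i in sequentially. dist t (p i) < \<delta>"
        using dist_p \<open>\<delta> > 0\<close> by (rule order_tendstoD)
      moreover have "\<forall>\<^sub>F i in sequentially. \<forall>u\<in>T \<inter> cball 0 (norm t + r). infdist u (G i) < \<delta>"
        using \<open>r > 0\<close> \<open>\<delta> > 0\<close> by (intro near) (auto intro: add_nonneg_pos)
      ultimately have "\<forall>\<^sub>F i in sequentially. R i * (r + 2 * \<delta>) < rK \<and> dist t (p i) < \<delta> \<and>
          (\<forall>u\<in>T \<inter> cball 0 (norm t + r). infdist u (G i) < \<delta>)"
        by eventually_elim auto
      then obtain i where i: "R i * (r + 2 * \<delta>) < rK" "dist t (p i) < \<delta>"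
        "\<And>u. u \<in> T \<Longrightarrow> norm u \<le> norm t + r \<Longrightarrow> infdist u (G i) < \<delta>"
        by (auto simp: eventually_sequentially)
      show ?thesis
      proof (rule unilateral_approximability_perturb[OF local_approximation_class_no_empty_set[OF \<S>]
            \<open>r > 0\<close> _ \<open>\<delta> > 0\<close> G])
        show "\<epsilon>' \<ge> 0" using that \<open>\<epsilon> \<ge> 0\<close> by simp
        show "dist t (p i) \<le> \<delta>" using i(2) by simp
        show "infdist u (G i) < \<delta>" if "u \<in> T" "dist t u \<le> r" for u
        proof (rule i(3)[OF that(1)])
          show "norm u \<le> norm t + r"
            using that(2) norm_triangle_sub[of u t] by (simp add: dist_norm norm_minus_commute)
        qed
        show "unilateral_approximability \<S> (G i) (p i) (r + 2 * \<delta>) \<le> ennreal \<epsilon>'"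
          unfolding G_def using i(1) R(1)[of i] \<open>r > 0\<close> \<open>\<delta> > 0\<close> \<open>\<epsilon>' \<ge> 0\<close>
          by (intro unilateral_approximability_blowup[OF \<S>] rK(2)[of _ i, unfolded a_def]) auto
      qed
    qed
    show ?thesis
    proof (rule ennreal_le_epsilon)
      fix \<eta> :: real assume "\<eta> > 0"
      \<comment> \<open>One half of \<open>\<eta>\<close> is spent on \<open>\<epsilon>'\<close>, the other on the error due to \<open>\<delta>\<close>.\<close>
      define \<epsilon>' where "\<epsilon>' = \<epsilon> + \<eta> / 2"
      define \<delta> where "\<delta> = \<eta> * r / (4 * (1 + \<epsilon>'))"
      have "\<epsilon>' > \<epsilon>" "1 + \<epsilon>' > 0" using \<open>\<eta> > 0\<close> \<open>\<epsilon> \<ge> 0\<close> by (auto simp: \<epsilon>'_def)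
      then have "\<delta> > 0" using \<open>\<eta> > 0\<close> \<open>r > 0\<close> by (simp add: \<delta>_def)
      have "\<delta> * (4 * (1 + \<epsilon>')) = \<eta> * r"
        using \<open>1 + \<epsilon>' > 0\<close> unfolding \<delta>_def by (intro nonzero_eq_divide_eq[THEN iffD1]) auto
      then have "2 * \<delta> * (1 + \<epsilon>') / r = \<eta> / 2"
        using \<open>r > 0\<close> by (simp add: field_simps)
      then have "\<epsilon>' + 2 * \<delta> * (1 + \<epsilon>') / r = \<epsilon> + \<eta>"
        by (simp add: \<epsilon>'_def)
      then show "unilateral_approximability \<S> T t r \<le> ennreal \<epsilon> + ennreal \<eta>"
        using step[OF \<open>\<epsilon>' > \<epsilon>\<close> \<open>\<delta> > 0\<close>] \<open>\<epsilon> \<ge> 0\<close> \<open>\<eta> > 0\<close> by (simp flip: ennreal_plus)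
    qed
  qed
  then show "T \<in> enlargement_everywhere \<S> \<epsilon>"
    using T by (simp add: enlargement_everywhere_def)
qed

lemma enlargement_everywhere_subset_enlargement_at_0:
  "enlargement_everywhere \<S> \<epsilon> \<subseteq> enlargement_at_0 \<S> \<epsilon>"
  by (auto simp: enlargement_everywhere_def enlargement_at_0_def closed_sets_through_0_def)

text \<open>A failure of approximability along points of a compact set, with radii tending to \<open>0\<close>, is
  normalised by blowing up to radius \<open>1\<close>; a limit of these blow-ups is a pseudotangent that satisfies
  the bound, and by stability so does one of the blow-ups.\<close>

lemma locally_unilaterally_approximable_if_pseudotangent_sets:
  fixes \<S> :: "'a::euclidean_space set set"
  assumes \<S>: "local_approximation_class \<S>" and "\<epsilon> \<ge> 0" "\<epsilon>' > \<epsilon>"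
    and tan: "\<And>x. x \<in> A \<Longrightarrow> pseudotangent_sets (closure A) x \<subseteq> enlargement_at_0 \<S> \<epsilon>"
  shows "locally_unilaterally_approximable \<S> \<epsilon>' A"
proof (rule ccontr)
  assume "\<not> ?thesis"
  then obtain K where K: "compact K" "K \<subseteq> A"
    and bad: "\<And>\<rho>. \<rho> > 0 \<Longrightarrow> \<exists>x\<in>K. \<exists>r. 0 < r \<and> r \<le> \<rho> \<and>
        \<not> unilateral_approximability \<S> A x r \<le> ennreal \<epsilon>'"
    unfolding locally_unilaterally_approximable_def by metis
  have "\<exists>x r. x \<in> K \<and> 0 < r \<and> r \<le> inverse (real (Suc i)) \<and>
      \<not> unilateral_approximability \<S> A x r \<le> ennreal \<epsilon>'" for i
    using bad[of "inverse (real (Suc i))"] by auto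
  then obtain X R where XK: "\<And>i. X i \<in> K" and R: "\<And>i. R i > 0"
    "\<And>i. R i \<le> inverse (real (Suc i))"
    and far: "\<And>i. \<not> unilateral_approximability \<S> A (X i) (R i) \<le> ennreal \<epsilon>'"
    by metis
  obtain x s where x: "x \<in> K" and s: "strict_mono (s::nat\<Rightarrow>nat)" and Xs: "(X \<circ> s) \<longlonglongrightarrow> x"
    using K(1) XK unfolding compact_def by metis
  define F where "F i = (\<lambda>y. (y - X (s i)) /\<^sub>R R (s i)) ` closure A" for i
  have XA: "X i \<in> A" for i using XK K(2) by blast
  then have F0: "0 \<in> F i" for i
    using closure_subset by (force simp: F_def)
  obtain k T where k: "strict_mono k" and T: "T \<in> closed_sets_through_0"
    and AW: "AW_converges (F \<circ> k) T"
    using AW_convergent_subsequence[of F] F0 by metis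
  have "R \<longlonglongrightarrow> 0"
    by (rule Lim_null_comparison[OF _ LIMSEQ_inverse_real_of_nat])
      (use R in \<open>auto simp: abs_of_pos\<close>)
  then have "(R \<circ> (s \<circ> k)) \<longlonglongrightarrow> 0"
    by (intro LIMSEQ_subseq_LIMSEQ strict_mono_o s k)
  moreover have "(X \<circ> (s \<circ> k)) \<longlonglongrightarrow> x"
    using LIMSEQ_subseq_LIMSEQ[OF Xs k] by (simp add: o_assoc)
  ultimately have "T \<in> pseudotangent_sets (closure A) x"
    unfolding pseudotangent_sets_def using T AW XA R(1)
    by (auto simp: F_def o_def intro!: closure_subset[THEN subsetD]
        exI[of _ "X \<circ> (s \<circ> k)"] exI[of _ "R \<circ> (s \<circ> k)"])
  then have \<beta>T: "unilateral_approximability \<S> T 0 r \<le> ennreal \<epsilon>" if "r > 0" for r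
    using tan x K(2) that unfolding enlargement_at_0_def by blast
  \<comment> \<open>The error bound \<open>\<epsilon> + 2 * \<delta> * (1 + \<epsilon>)\<close> at radius \<open>1\<close> then equals \<open>\<epsilon>'\<close>.\<close>
  define \<delta> where "\<delta> = (\<epsilon>' - \<epsilon>) / (2 * (1 + \<epsilon>))"
  have "\<delta> > 0" using \<open>\<epsilon> \<ge> 0\<close> \<open>\<epsilon>' > \<epsilon>\<close> by (simp add: \<delta>_def)
  have "\<delta> * (2 * (1 + \<epsilon>)) = \<epsilon>' - \<epsilon>"
    using \<open>\<epsilon> \<ge> 0\<close> unfolding \<delta>_def by (intro nonzero_eq_divide_eq[THEN iffD1]) auto
  then have \<delta>_eq: "\<epsilon> + 2 * \<delta> * (1 + \<epsilon>) / 1 = \<epsilon>'"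
    by (simp add: algebra_simps)
  have "T \<noteq> {}" using T by (auto simp: closed_sets_through_0_def)
  have "(F \<circ> k) i \<noteq> {}" for i using F0[of "k i"] by auto
  then have "\<forall>\<^sub>F i in sequentially. \<forall>y\<in>(F \<circ> k) i \<inter> cball 0 1. infdist y T \<le> \<delta> / 2"
    using AW_convergesD(1)[OF AW _ \<open>T \<noteq> {}\<close>, of 1 "\<delta> / 2"] \<open>\<delta> > 0\<close> by simp
  then obtain i where "\<forall>y\<in>F (k i) \<inter> cball 0 1. infdist y T \<le> \<delta> / 2"
    unfolding eventually_sequentially o_def by (meson order_refl)
  then have i: "\<And>y. y \<in> F (k i) \<Longrightarrow> norm y \<le> 1 \<Longrightarrow> infdist y T \<le> \<delta> / 2"
    by simp
  let ?B = "(\<lambda>y. (y - X (s (k i))) /\<^sub>R R (s (k i))) ` A"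
  have "?B \<subseteq> F (k i)"
    unfolding F_def by (intro image_mono closure_subset)
  then have "infdist u T < \<delta>" if "u \<in> ?B" "dist 0 u \<le> 1" for u
  proof -
    have "infdist u T \<le> \<delta> / 2"
      using \<open>?B \<subseteq> F (k i)\<close> that by (intro i) (blast, simp)
    then show ?thesis using \<open>\<delta> > 0\<close> by simp
  qed
  then have "unilateral_approximability \<S> ?B 0 1 \<le> ennreal (\<epsilon> + 2 * \<delta> * (1 + \<epsilon>) / 1)"
    using \<open>\<delta> > 0\<close>
    by (intro unilateral_approximability_perturb[OF local_approximation_class_no_empty_set[OF \<S>]
          _ \<open>\<epsilon> \<ge> 0\<close> \<open>\<delta> > 0\<close> \<open>T \<noteq> {}\<close>, where p = 0] \<beta>T) auto
  then have "unilateral_approximability \<S> A (X (s (k i))) (R (s (k i))) \<le> ennreal \<epsilon>'"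
    using \<open>\<epsilon> \<ge> 0\<close> \<open>\<epsilon>' > \<epsilon>\<close> unfolding \<delta>_eq
    by (intro unilateral_approximability_blowupD[OF \<S> R(1)]) auto
  then show False using far by blast
qed

theorem theorem7p10:
  fixes \<S> :: "(real ^ 'n) set set" and A :: "(real ^ 'n) set" and \<epsilon> :: real
  assumes "local_approximation_class \<S>"
    and "A \<noteq> {}"
    and "\<epsilon> \<ge> 0"
  shows "((\<forall>\<epsilon>'>\<epsilon>. locally_unilaterally_approximable \<S> \<epsilon>' A) \<longleftrightarrow>
            (\<forall>x\<in>A. pseudotangent_sets (closure A) x \<subseteq> enlargement_at_0 \<S> \<epsilon>)) \<and>
         ((\<forall>x\<in>A. pseudotangent_sets (closure A) x \<subseteq> enlargement_at_0 \<S> \<epsilon>) \<longleftrightarrow>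
            (\<forall>x\<in>A. pseudotangent_sets (closure A) x \<subseteq> enlargement_everywhere \<S> \<epsilon>))"
proof -
  have "\<forall>x\<in>A. pseudotangent_sets (closure A) x \<subseteq> enlargement_everywhere \<S> \<epsilon>"
    if "\<forall>\<epsilon>'>\<epsilon>. locally_unilaterally_approximable \<S> \<epsilon>' A"
    using pseudotangent_sets_subset_enlargement_everywhere[OF assms(1,3)] that by blast
  moreover have "\<forall>\<epsilon>'>\<epsilon>. locally_unilaterally_approximable \<S> \<epsilon>' A"
    if "\<forall>x\<in>A. pseudotangent_sets (closure A) x \<subseteq> enlargement_at_0 \<S> \<epsilon>"
    using locally_unilaterally_approximable_if_pseudotangent_sets[OF assms(1,3)] that by blast
  ultimately show ?thesis
    using enlargement_everywhere_subset_enlargement_at_0 by blast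
qed

end
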